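(* The following algorithm decides whether a connected strongly-proportional allocation exists for $n$ agents (not necessarily hungry, with arbitrary entitlements $\mathbf{w}$) using at most $n\cdot 2^{n-1}$ queries. Set $b_\emptyset=0$. For $k=1,\dots,n$ and each subset $N\subseteq[n]$ with $|N|=k$: set $b_N=\infty$, and for each $i\in N$ compute $y=\textsc{Mark}_i(b_{N\setminus\{i\}},w_i)$ and, if $y<b_N$, set $b_N=y$. Finally return "true" if $b_{[n]}<1$ and "false" otherwise.
   Context: The cake is $C=[0,1]$, to be divided among agents $[n]$. Each agent $i$ has a valuation function $V_i$ on the algebra generated by intervals of $C$ that is non-negative, finitely additive, normalized ($V_i(C)=1$), with $x\mapsto V_i([0,x])$ continuous. Entitlements are $w_i>0$ with $\sum_i w_i=1$. An allocation is a partition $C=X_1\sqcup\cdots\sqcup X_n$ into finite unions of closed intervals, pairwise disjoint except possibly at endpoints; it is connected if each $X_i$ is a single interval and strongly-proportional if $V_i(X_i)>w_i$ for all $i$. Queries (each counts as one): $\textsc{Eval}_i(x,y)=V_i([x,y])$; $\textsc{Mark}_i(x,r)$ returns the largest $z\in C$ with $V_i([x,z])=r$, or $\infty$ if $V_i([x,1])<r$ (with the convention that $\textsc{Mark}_i(\infty,r)=\infty$).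
   Formalization: Valuations are additionally assumed to give the single point 0 value zero (no atom at 0); continuity of V_i([0,x]) on [0,1] alone allows such an atom, and then Mark may be undefined and the algorithm may wrongly answer "true". *)

theory Defs
  imports "HOL-Analysis.Analysis" "HOL-Combinatorics.Multiset_Permutations"
begin

section \<open>Valuations\<close>

definition cake :: "real set" where
  "cake = {0..1}"

definition cake_algebra :: "real set set" where
  "cake_algebra = algebra cake hull {I. is_interval I \<and> I \<subseteq> cake}"

text \<open>
  Only the values on \<^const>\<open>cake_algebra\<close> are constrained.
  Continuity on \<open>[0,1]\<close> together with additivity gives \<open>V {x} = 0\<close> for \<open>0 < x\<close> only; the
  last conjunct says that there is no atom at \<open>0\<close> either, i.e. that \<open>V [0,x]\<close> is continuous at
  \<open>0\<close> also from the left, where \<open>[0,x]\<close> is empty.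
  With an atom at \<open>0\<close>, there may be no \<open>z\<close> with \<open>V [0,z] = r\<close> although \<open>r \<le> V [0,1]\<close>,
  and the algorithm would be incorrect: take two agents with entitlements \<open>1/2\<close>, both valuing
  \<open>{0}\<close> at \<open>1/2\<close> and the rest uniformly.
\<close>

definition valuation :: "(real set \<Rightarrow> real) \<Rightarrow> bool" where
  "valuation V \<longleftrightarrow>
     (\<forall>A\<in>cake_algebra. 0 \<le> V A) \<and>
     Measure_Space.additive cake_algebra V \<and>
     V cake = 1 \<and>
     continuous_on {0..1} (\<lambda>x. V {0..x}) \<and>
     V {0} = 0"


section \<open>Allocations\<close>

text \<open>Agents are \<open>1, \<dots>, n\<close>; \<open>X i\<close> is the piece of agent \<open>i\<close>.\<close>

definition cake_interval :: "real set \<Rightarrow> bool" where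
  "cake_interval I \<longleftrightarrow> (\<exists>a b. 0 \<le> a \<and> a \<le> b \<and> b \<le> 1 \<and> I = {a..b})"

text \<open>The frontier of a finite union of closed intervals consists of the endpoints of its components.\<close>

definition allocation :: "nat \<Rightarrow> (nat \<Rightarrow> real set) \<Rightarrow> bool" where
  "allocation n X \<longleftrightarrow>
     (\<forall>i\<in>{1..n}. \<exists>F. finite F \<and> (\<forall>I\<in>F. cake_interval I) \<and> X i = \<Union>F) \<and>
     (\<Union>i\<in>{1..n}. X i) = cake \<and>
     (\<forall>i\<in>{1..n}. \<forall>j\<in>{1..n}. i \<noteq> j \<longrightarrow> X i \<inter> X j \<subseteq> frontier (X i) \<inter> frontier (X j))"

definition connected_allocation :: "nat \<Rightarrow> (nat \<Rightarrow> real set) \<Rightarrow> bool" where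
  "connected_allocation n X \<longleftrightarrow> allocation n X \<and> (\<forall>i\<in>{1..n}. cake_interval (X i))"

definition strongly_proportional ::
    "nat \<Rightarrow> (nat \<Rightarrow> real set \<Rightarrow> real) \<Rightarrow> (nat \<Rightarrow> real) \<Rightarrow> (nat \<Rightarrow> real set) \<Rightarrow> bool" where
  "strongly_proportional n V w X \<longleftrightarrow> (\<forall>i\<in>{1..n}. V i (X i) > w i)"


section \<open>The query model\<close>

text \<open>
  An algorithm is a decision tree whose inner nodes are queries; it has access to the
  valuations only through the answers to its queries. Positions are points of the cake or \<open>\<infinity>\<close>.
\<close>

datatype query = Eval nat real real | Mark nat ereal real

fun answer :: "(nat \<Rightarrow> real set \<Rightarrow> real) \<Rightarrow> query \<Rightarrow> ereal" where
  "answer V (Eval i x y) = ereal (V i {x..y})"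
| "answer V (Mark i x r) =
     (if x = \<infinity> \<or> V i {real_of_ereal x..1} < r then \<infinity>
      else ereal (GREATEST z. z \<in> cake \<and> V i {real_of_ereal x..z} = r))"

datatype 'a algorithm = Return 'a | Ask query "ereal \<Rightarrow> 'a algorithm"

primrec bind_alg :: "'a algorithm \<Rightarrow> ('a \<Rightarrow> 'b algorithm) \<Rightarrow> 'b algorithm" where
  "bind_alg (Return a) f = f a"
| "bind_alg (Ask q c) f = Ask q (\<lambda>y. bind_alg (c y) f)"

primrec for_each :: "'a list \<Rightarrow> ('a \<Rightarrow> 's \<Rightarrow> 's algorithm) \<Rightarrow> 's \<Rightarrow> 's algorithm" where
  "for_each [] f s = Return s"
| "for_each (x # xs) f s = bind_alg (f x s) (for_each xs f)"

primrec result :: "(nat \<Rightarrow> real set \<Rightarrow> real) \<Rightarrow> 'a algorithm \<Rightarrow> 'a" where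
  "result V (Return a) = a"
| "result V (Ask q c) = result V (c (answer V q))"

primrec num_queries :: "(nat \<Rightarrow> real set \<Rightarrow> real) \<Rightarrow> 'a algorithm \<Rightarrow> nat" where
  "num_queries V (Return a) = 0"
| "num_queries V (Ask q c) = Suc (num_queries V (c (answer V q)))"


section \<open>The algorithm\<close>

text \<open>
  The state is the table \<open>b\<close>. The lists \<open>subs k\<close> and \<open>agents N\<close> are the orders in which the
  loops run through the \<open>k\<close>-element sets of agents and through the elements of \<open>N\<close>.
\<close>

definition agent_step ::
    "(nat \<Rightarrow> real) \<Rightarrow> nat set \<Rightarrow> nat \<Rightarrow> (nat set \<Rightarrow> ereal) \<Rightarrow> (nat set \<Rightarrow> ereal) algorithm" where
  "agent_step w N i b =
     Ask (Mark i (b (N - {i})) (w i)) (\<lambda>y. Return (if y < b N then b(N := y) else b))"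

definition subset_step ::
    "(nat \<Rightarrow> real) \<Rightarrow> (nat set \<Rightarrow> nat list) \<Rightarrow> nat set \<Rightarrow> (nat set \<Rightarrow> ereal) \<Rightarrow>
     (nat set \<Rightarrow> ereal) algorithm" where
  "subset_step w agents N b = for_each (agents N) (agent_step w N) (b(N := \<infinity>))"

definition strong_prop_algorithm ::
    "nat \<Rightarrow> (nat \<Rightarrow> real) \<Rightarrow> (nat \<Rightarrow> nat set list) \<Rightarrow> (nat set \<Rightarrow> nat list) \<Rightarrow> bool algorithm" where
  "strong_prop_algorithm n w subs agents =
     bind_alg
       (for_each [1..<Suc n] (\<lambda>k. for_each (subs k) (subset_step w agents))
          ((\<lambda>_. undefined)({} := 0)))
       (\<lambda>b. Return (b {1..n} < 1))"

end

theory Submission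
  imports Defs
begin

text \<open>
  The table entry \<open>b N\<close> is the infimum of the points \<open>z\<close> such that \<open>[0,z]\<close> can be cut into
  consecutive intervals, one for each agent in \<open>N\<close>, each worth more than the entitlement of its
  owner. Since marks are rightmost, passing a mark strictly yields strictly more value, and by
  continuity of the valuations some of this surplus can be handed to the agents further left.
  So a division of \<open>[0,z]\<close> exists exactly if \<open>b N < z\<close>, and \<open>z = 1\<close> is the theorem.
  A set of \<open>k\<close> agents costs \<open>k\<close> queries, whence the bound \<open>(\<Sum>k\<le>n. k * (n choose k))\<close>.
\<close>

section \<open>Valuations of intervals\<close>

lemma interval_in_cake_algebra:
  assumes "is_interval I" "I \<subseteq> {0..1}"
  shows "I \<in> cake_algebra"
  using assms unfolding cake_algebra_def cake_def by (intro hull_inc) auto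

lemma valuation_additive:
  assumes "valuation V" "is_interval I" "is_interval J" "I \<union> J \<subseteq> {0..1}" "I \<inter> J = {}"
  shows "V (I \<union> J) = V I + V J"
  using assms interval_in_cake_algebra unfolding valuation_def Measure_Space.additive_def by simp

lemma valuation_nonneg:
  assumes "valuation V" "is_interval I" "I \<subseteq> {0..1}"
  shows "0 \<le> V I"
  using assms interval_in_cake_algebra unfolding valuation_def by simp

lemma valuation_empty:
  assumes "valuation V"
  shows "V {} = 0"
  using valuation_additive[OF assms, of "{}" "{}"] by simp

text \<open>For x > 0 the point is worth at most \<open>V {0..x} - V {0..y}\<close> for every y < x,
  and this difference vanishes as y tends to x by continuity. The point 0 has nothing to its left
  and is covered by the last conjunct of \<open>valuation_def\<close>.\<close>

lemma valuation_singleton: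
  assumes V: "valuation V" and x: "0 \<le> x" "x \<le> 1"
  shows "V {x} = 0"
proof (cases "x = 0")
  case True
  then show ?thesis using V by (simp add: valuation_def)
next
  case False
  then have "0 < x" using x by simp
  have le: "V {x} \<le> V {0..x} - V {0..y}" if y: "0 \<le> y" "y < x" for y
  proof -
    have "{0..y} \<union> {y<..x} = {0..x}" "{0..y} \<inter> {y<..x} = {}" using y by auto
    then have 1: "V {0..x} = V {0..y} + V {y<..x}"
      using valuation_additive[OF V, of "{0..y}" "{y<..x}"] y x
      by (auto simp: is_interval_cc is_interval_oc)
    have "{y<..<x} \<union> {x} = {y<..x}" "is_interval {x}" "{y<..x} \<subseteq> {0..1}"
      using y x by (auto simp: is_interval_cc[of x x, simplified])
    then have 2: "V {y<..x} = V {y<..<x} + V {x}"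
      using valuation_additive[OF V, of "{y<..<x}" "{x}"] y x
      by (auto simp: is_interval_oo)
    have "0 \<le> V {y<..<x}"
      using y x by (intro valuation_nonneg[OF V]) (auto simp: is_interval_oo)
    then show ?thesis using 1 2 by simp
  qed
  have "continuous_on {0..1} (\<lambda>x. V {0..x})" using V by (simp add: valuation_def)
  then have "((\<lambda>y. V {0..y}) \<longlongrightarrow> V {0..x}) (at x within {0..1})"
    using x by (simp add: continuous_on)
  \<comment> \<open>Only points to the left of x are wanted, since \<open>le\<close> speaks of
    those; x > 0 keeps the restricted filter nontrivial.\<close>
  then have lim: "((\<lambda>y. V {0..y}) \<longlongrightarrow> V {0..x}) (at x within {0..<x})"
    by (rule tendsto_within_subset) (use x in auto)
  have nontriv: "at x within {0..<x} \<noteq> bot"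
    using \<open>0 < x\<close> by (simp add: at_within_eq_bot_iff)
  have "V {x} \<le> V {0..x} - V {0..x}"
    by (rule tendsto_lowerbound[OF tendsto_diff[OF tendsto_const lim] _ nontriv])
      (auto simp: eventually_at_filter intro!: le always_eventually)
  moreover have "0 \<le> V {x}"
    using valuation_nonneg[OF V, of "{x..x}"] x is_interval_cc[of x x] by simp
  ultimately show ?thesis by simp
qed

text \<open>\<open>{0..x}\<close> and \<open>{x..y}\<close> share the point x, so additivity is
  applied to \<open>{0..<x}\<close> instead; the shared point is worth nothing.\<close>

lemma valuation_interval:
  assumes V: "valuation V" and xy: "0 \<le> x" "x \<le> y" "y \<le> 1"
  shows "V {x..y} = V {0..y} - V {0..x}"
proof -
  have "{0..<x} \<union> {x..y} = {0..y}" "{0..<x} \<union> {x} = {0..x}" "{0..<x} \<inter> {x..y} = {}"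
    "is_interval {x}"
    using xy by (auto simp: is_interval_cc[of x x, simplified])
  then have "V {0..y} = V {0..<x} + V {x..y}" "V {0..x} = V {0..<x} + V {x}"
    using valuation_additive[OF V, of "{0..<x}" "{x..y}"]
      valuation_additive[OF V, of "{0..<x}" "{x}"] xy
    by (auto simp: is_interval_cc is_interval_co)
  then show ?thesis using valuation_singleton[OF V, of x] xy by simp
qed

lemma valuation_mono:
  assumes V: "valuation V" and "0 \<le> x'" "x' \<le> x" "x \<le> y" "y \<le> y'" "y' \<le> 1"
  shows "V {x..y} \<le> V {x'..y'}"
proof -
  have "V {x..y} = V {0..y} - V {0..x}" "V {x'..y'} = V {0..y'} - V {0..x'}"
    "V {x'..x} = V {0..x} - V {0..x'}" "V {y..y'} = V {0..y'} - V {0..y}"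
    using assms by (auto intro!: valuation_interval)
  moreover have "0 \<le> V {x'..x}" "0 \<le> V {y..y'}"
    using assms by (auto intro!: valuation_nonneg simp: is_interval_cc)
  ultimately show ?thesis by linarith
qed

text \<open>Continuity of the value of \<open>{0..y}\<close> at x from the right: a strict surplus
  survives a small shift of the left endpoint. This is what lets a piece give up some cake to the
  agents on its left.\<close>

lemma valuation_shrink_left:
  assumes V: "valuation V" and x: "0 \<le> x" "x < z" "z \<le> 1" and r: "r < V {x..z}"
  obtains y where "x < y" "y < z" "r < V {y..z}"
proof -
  have "continuous_on {0..1} (\<lambda>x. V {0..x})" using V by (simp add: valuation_def)
  then have "((\<lambda>y. V {0..y}) \<longlongrightarrow> V {0..x}) (at x within {0..1})"
    using x by (simp add: continuous_on)
  then have lim: "((\<lambda>y. V {0..y}) \<longlongrightarrow> V {0..x}) (at x within {x<..<z})"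
    by (rule tendsto_within_subset) (use x in auto)
  have "V {0..x} < V {0..z} - r" using valuation_interval[OF V, of x z] x r by simp
  then have "\<forall>\<^sub>F y in at x within {x<..<z}. V {0..y} < V {0..z} - r"
    using lim by (simp add: order_tendsto_iff)
  moreover have "\<forall>\<^sub>F y in at x within {x<..<z}. y \<in> {x<..<z}"
    by (simp add: eventually_at_filter)
  ultimately have "\<forall>\<^sub>F y in at x within {x<..<z}. y \<in> {x<..<z} \<and> V {0..y} < V {0..z} - r"
    by eventually_elim simp
  moreover have "at x within {x<..<z} \<noteq> bot"
    using x by (simp add: at_within_eq_bot_iff)
  ultimately obtain y where y: "x < y" "y < z" "V {0..y} < V {0..z} - r"
    using eventually_happens' by fastforce
  then have "r < V {y..z}" using valuation_interval[OF V, of y z] x by simp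
  with y that show ?thesis by blast
qed

section \<open>Mark queries\<close>

text \<open>Shows that \<open>GREATEST\<close> in the answer is well defined: the intermediate value
  theorem yields a point where the value is r, and the set of such points is compact, so it has a
  largest element.\<close>

lemma answer_Mark_cases [consumes 4]:
  assumes V: "valuation (V i)" and x: "0 \<le> x" "x \<le> 1" and r: "0 < r"
  obtains (infinite) "V i {x..1} < r" "answer V (Mark i (ereal x) r) = \<infinity>"
  | (finite) m where "r \<le> V i {x..1}" "answer V (Mark i (ereal x) r) = ereal m"
      "x \<le> m" "m \<le> 1" "V i {x..m} = r" "\<And>z. m < z \<Longrightarrow> z \<le> 1 \<Longrightarrow> V i {x..z} \<noteq> r"
proof (cases "V i {x..1} < r")
  case True
  then show ?thesis using infinite by simp
next
  case False
  let ?F = "\<lambda>z. V i {0..z}"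
  let ?S = "{z \<in> {x..1}. ?F z = r + ?F x}"
  have cont: "continuous_on {x..1} ?F"
    using V x by (auto simp: valuation_def intro: continuous_on_subset)
  \<comment> \<open>The query ranges over the whole cake, but a point z < x gives an empty interval
    of value 0, which differs from r because r > 0.\<close>
  have S: "z \<in> ?S \<longleftrightarrow> z \<in> cake \<and> V i {x..z} = r" for z
  proof (cases "x \<le> z \<and> z \<le> 1")
    case True
    then show ?thesis using valuation_interval[OF V, of x z] x by (auto simp: cake_def)
  next
    case False
    then show ?thesis using valuation_empty[OF V] r by (auto simp: cake_def)
  qed
  have "\<exists>z\<ge>x. z \<le> 1 \<and> ?F z = r + ?F x"
    by (rule IVT') (use False r x cont valuation_interval[OF V, of x 1] in auto)
  then have "?S \<noteq> {}" by auto
  moreover have "closed ?S"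
    using continuous_closed_preimage_constant[OF cont, of "r + ?F x"] by simp
  then have "compact ?S"
    by (rule compact_eq_bounded_closed[THEN iffD2, OF conjI, rotated])
      (rule bounded_subset[OF bounded_closed_interval[of x 1]], auto)
  ultimately have "\<exists>m\<in>?S. \<forall>z\<in>?S. z \<le> m" by (intro compact_attains_sup)
  then obtain m where m: "m \<in> ?S" "\<And>z. z \<in> ?S \<Longrightarrow> z \<le> m" by (elim bexE) simp
  have "(GREATEST z. z \<in> cake \<and> V i {x..z} = r) = m"
    by (rule Greatest_equality) (use m in \<open>simp_all only: S[symmetric]\<close>)
  moreover have "V i {x..z} \<noteq> r" if "m < z" "z \<le> 1" for z
    using m(2)[of z] S[of z] that m(1) x by (simp only: cake_def) auto
  ultimately show ?thesis
    using False m(1) S[of m] by (intro finite[of m]) auto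
qed

text \<open>Marks stay folded from here on, so that finite positions are handled by the case rule
  and not by unfolding \<open>GREATEST\<close>.\<close>

declare answer.simps(2) [simp del]

lemma answer_Mark_infinity [simp]: "answer V (Mark i \<infinity> r) = \<infinity>"
  by (simp add: answer.simps(2))

lemma answer_Mark_bounds:
  assumes V: "valuation (V i)" and x: "0 \<le> x" "x \<le> 1" and r: "0 < r"
  shows "0 \<le> answer V (Mark i (ereal x) r) \<and>
    (answer V (Mark i (ereal x) r) \<noteq> \<infinity> \<longrightarrow> answer V (Mark i (ereal x) r) \<le> 1)"
  using V x r by (cases rule: answer_Mark_cases[of V i x r]) (use x in \<open>auto simp: one_ereal_def\<close>)

text \<open>Maximality of the mark m is decisive: beyond m the value is at least r by monotonicity
  and never equal to r, hence larger. Up to m it is at most r. If the mark is infinite, even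
  \<open>{x..1}\<close> is worth less than r.\<close>

lemma answer_Mark_less_iff:
  assumes V: "valuation (V i)" and x: "0 \<le> x" "x \<le> 1" and r: "0 < r" and z: "z \<le> 1"
  shows "answer V (Mark i (ereal x) r) < ereal z \<longleftrightarrow> x < z \<and> r < V i {x..z}"
  using V x r
proof (cases rule: answer_Mark_cases[of V i x r])
  case infinite
  have "V i {x..z} \<le> V i {x..1}" if "x < z"
    using valuation_mono[OF V, of x x z 1] that x z by simp
  then show ?thesis using infinite by (auto)
next
  case (finite m)
  have "r < V i {x..z}" if "m < z"
    using valuation_mono[OF V, of x x m z] finite(3,5) finite(6)[of z] that x z by fastforce
  moreover have "m < z" if "x < z" "r < V i {x..z}"
    using valuation_mono[OF V, of x x z m] finite(3-5) that x z by (cases "m < z") auto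
  ultimately show ?thesis using finite(2,3) by (auto)
qed

section \<open>Sequential divisions\<close>

text \<open>Built from left to right, the inserted agent taking the rightmost piece, so that the
  rule has the same shape as the recursion from \<open>b (N - {i})\<close> to \<open>b N\<close>.
  Without agents only the right end 0 is possible.\<close>

inductive sequential_division ::
    "(nat \<Rightarrow> real set \<Rightarrow> real) \<Rightarrow> (nat \<Rightarrow> real) \<Rightarrow> nat set \<Rightarrow> real \<Rightarrow> bool" for V w where
  empty: "sequential_division V w {} 0"
| insert: "sequential_division V w N x \<Longrightarrow> i \<notin> N \<Longrightarrow> x < z \<Longrightarrow> w i < V i {x..z} \<Longrightarrow>
    sequential_division V w (insert i N) z"

lemma sequential_division_finite:
  "sequential_division V w N z \<Longrightarrow> finite N"
  by (induction rule: sequential_division.induct) auto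

lemma sequential_division_nonneg:
  "sequential_division V w N z \<Longrightarrow> 0 \<le> z"
  by (induction rule: sequential_division.induct) auto

lemma frontier_atLeastAtMost_real:
  "frontier {a..b::real} = (if a \<le> b then {a, b} else {})"
  by (auto simp: frontier_def interior_atLeastAtMost_real)

text \<open>The point 0 is inserted in the covering statement so that it also holds for the empty
  division, where there are no pieces but \<open>{0..0}\<close> is a point.\<close>

lemma sequential_division_pieces:
  assumes "sequential_division V w N z"
  shows "\<exists>X. (\<forall>i\<in>N. \<exists>a b. 0 \<le> a \<and> a < b \<and> b \<le> z \<and> X i = {a..b}) \<and>
    insert 0 (\<Union>i\<in>N. X i) = {0..z} \<and>
    (\<forall>i\<in>N. \<forall>j\<in>N. i \<noteq> j \<longrightarrow> X i \<inter> X j \<subseteq> frontier (X i) \<inter> frontier (X j)) \<and>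
    (\<forall>i\<in>N. w i < V i (X i))"
  using assms
proof (induction rule: sequential_division.induct)
  case empty
  then show ?case by simp
next
  case (insert N x i z)
  then obtain X where X: "\<And>j. j \<in> N \<Longrightarrow> \<exists>a b. 0 \<le> a \<and> a < b \<and> b \<le> x \<and> X j = {a..b}"
    "insert 0 (\<Union>j\<in>N. X j) = {0..x}"
    "\<And>j k. j \<in> N \<Longrightarrow> k \<in> N \<Longrightarrow> j \<noteq> k \<Longrightarrow> X j \<inter> X k \<subseteq> frontier (X j) \<inter> frontier (X k)"
    "\<And>j. j \<in> N \<Longrightarrow> w j < V j (X j)"
    by metis
  have x: "0 \<le> x" using insert.hyps(1) by (rule sequential_division_nonneg)
  let ?Y = "X(i := {x..z})"
  have old: "?Y j = X j" if "j \<in> N" for j using that insert.hyps(2) by auto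
  have pieces: "\<forall>j\<in>insert i N. \<exists>a b. 0 \<le> a \<and> a < b \<and> b \<le> z \<and> ?Y j = {a..b}"
    using X(1) old x insert.hyps(3) by (metis fun_upd_same insertE less_eq_real_def order_trans)
  have "insert 0 (\<Union>j\<in>insert i N. ?Y j) = insert 0 (\<Union>j\<in>N. X j) \<union> {x..z}"
    using insert.hyps(2) by (auto split: if_splits)
  also have "\<dots> = {0..z}" using X(2) x insert.hyps(3) by auto
  finally have cover: "insert 0 (\<Union>j\<in>insert i N. ?Y j) = {0..z}" .
  \<comment> \<open>Old pieces end at or before x, so the only possible common point is x, an
    endpoint of both.\<close>
  have new: "X j \<inter> {x..z} \<subseteq> frontier (X j) \<inter> frontier {x..z}" if "j \<in> N" for j
    using X(1)[OF that] insert.hyps(3) by (auto simp: frontier_atLeastAtMost_real)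
  have "?Y j \<inter> ?Y k \<subseteq> frontier (?Y j) \<inter> frontier (?Y k)"
    if "j \<in> insert i N" "k \<in> insert i N" "j \<noteq> k" for j k
    using that X(3)[of j k] new[of j] new[of k] by (cases "j = i"; cases "k = i") auto
  moreover have "\<forall>j\<in>insert i N. w j < V j (?Y j)"
    using X(4) old insert.hyps(4) by auto
  ultimately show ?case using pieces cover by blast
qed

text \<open>Induction on the number of pieces: the piece that contains z is the rightmost one;
  removing it leaves pieces that cover \<open>{0..a i}\<close>.\<close>

lemma sequential_division_of_pieces:
  assumes "finite N"
    and "\<And>i. i \<in> N \<Longrightarrow> a i < b i \<and> X i = {a i..b i} \<and> w i < V i (X i)"
    and "\<And>i j. i \<in> N \<Longrightarrow> j \<in> N \<Longrightarrow> i \<noteq> j \<Longrightarrow> X i \<inter> X j \<subseteq> frontier (X i) \<inter> frontier (X j)"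
    and "insert 0 (\<Union>i\<in>N. X i) = {0..z}"
  shows "sequential_division V w N z"
  using assms
proof (induction "card N" arbitrary: N z)
  case 0
  then have "N = {}" "{0} = {0..z}" by auto
  moreover from this have "z = 0"
    by (metis atLeastAtMost_singleton_iff)
  ultimately show ?case by (simp add: sequential_division.empty)
next
  case (Suc k)
  then obtain j where "j \<in> N" by fastforce
  have sub: "0 \<le> a i" "b i \<le> z" "a i < b i" "X i = {a i..b i}" if "i \<in> N" for i
  proof -
    show i: "a i < b i" "X i = {a i..b i}" using Suc.prems(2)[OF that] by auto
    then have "a i \<in> X i" "b i \<in> X i" by auto
    then have "a i \<in> {0..z}" "b i \<in> {0..z}" using that Suc.prems(4) by blast+
    then show "0 \<le> a i" "b i \<le> z" by auto
  qed
  have z: "0 < z" using sub[OF \<open>j \<in> N\<close>] by linarith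
  then have "z \<in> insert 0 (\<Union>i\<in>N. X i)" using Suc.prems(4) by auto
  with z obtain i where i: "i \<in> N" "z \<in> X i" by auto
  then have bi: "b i = z" using sub[OF i(1)] by auto
  let ?M = "N - {i}"
  \<comment> \<open>Otherwise the two pieces overlap in a nondegenerate interval, since
    \<open>b j\<close> is at most \<open>b i = z\<close>. Its midpoint \<open>?p\<close> lies in
    both pieces but is an endpoint of neither.\<close>
  have left: "b j \<le> a i" if j: "j \<in> ?M" for j
  proof (rule ccontr)
    assume neg: "\<not> b j \<le> a i"
    define l where "l = max (a i) (a j)"
    have l: "l < b j" "a i \<le> l" "a j \<le> l" using neg sub[of j] j by (auto simp: l_def)
    let ?p = "(l + b j) / 2"
    have p: "a i < ?p" "?p < b i" "a j < ?p" "?p < b j" using l sub[of j] j bi by auto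
    then have "?p \<in> X i \<inter> X j" using sub(4)[of j] sub(4)[OF i(1)] j by simp
    then have "?p \<in> frontier (X i)" using Suc.prems(3)[of i j] i(1) j by blast
    then have "?p = a i \<or> ?p = b i"
      using sub[OF i(1)] by (auto simp: frontier_atLeastAtMost_real)
    then show False using p by linarith
  qed
  let ?U = "insert 0 (\<Union>j\<in>?M. X j)"
  have "X j \<subseteq> {0..a i}" if "j \<in> ?M" for j
    using left[OF that] sub[of j] that by auto
  then have "?U \<subseteq> {0..a i}" using sub(1)[OF i(1)] by auto
  moreover have "{0..a i} \<subseteq> ?U"
  proof (cases "a i = 0")
    case True
    then show ?thesis by simp
  next
    case False
    \<comment> \<open>Points before \<open>a i\<close> must lie in other pieces, but
      \<open>a i\<close> itself lies in the removed one; closedness of the remaining union recovers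
      it. The case \<open>a i = 0\<close> is separate because then \<open>{0..<a i}\<close> is
      empty.\<close>
    have "closed ?U"
      using Suc.prems(1) sub(4) by (intro closed_insert closed_UN) auto
    moreover have "{0..<a i} \<subseteq> ?U"
    proof
      fix y assume y: "y \<in> {0..<a i}"
      then have "y \<in> insert 0 (\<Union>i\<in>N. X i)" using Suc.prems(4) sub[OF i(1)] by auto
      then show "y \<in> ?U" using y sub(4)[OF i(1)] by auto
    qed
    ultimately have "closure {0..<a i} \<subseteq> ?U" by (intro closure_minimal)
    moreover have "closure {0..<a i} = {0..a i}"
      using False sub(1)[OF i(1)] by (intro closure_atLeastLessThan) simp
    ultimately show ?thesis by simp
  qed
  ultimately have U: "?U = {0..a i}" by (rule equalityI)
  have "sequential_division V w ?M (a i)"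
  proof (rule Suc.hyps(1))
    show "k = card ?M" using Suc.hyps(2) Suc.prems(1) i(1) by simp
    show "finite ?M" using Suc.prems(1) by simp
    show "a j < b j \<and> X j = {a j..b j} \<and> w j < V j (X j)" if "j \<in> ?M" for j
      using Suc.prems(2)[of j] that by blast
    show "X j \<inter> X l \<subseteq> frontier (X j) \<inter> frontier (X l)" if "j \<in> ?M" "l \<in> ?M" "j \<noteq> l" for j l
      using Suc.prems(3)[of j l] that by blast
  qed (rule U)
  then have "sequential_division V w (insert i ?M) z"
    by (rule sequential_division.insert) (use sub[OF i(1)] bi Suc.prems(2)[OF i(1)] in auto)
  then show ?case using i(1) by (simp add: insert_absorb)
qed

text \<open>An allocation gives unordered, possibly degenerate intervals. Degenerate ones are
  excluded by positive entitlements, and the order comes from peeling off rightmost pieces.\<close>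

lemma allocation_iff_sequential_division:
  assumes V: "\<And>i. i \<in> {1..n} \<Longrightarrow> valuation (V i)"
    and w: "\<And>i. i \<in> {1..n} \<Longrightarrow> 0 < w i"
    and n: "0 < n"
  shows "(\<exists>X. connected_allocation n X \<and> strongly_proportional n V w X) \<longleftrightarrow>
    sequential_division V w {1..n} 1"
proof
  assume "\<exists>X. connected_allocation n X \<and> strongly_proportional n V w X"
  then obtain X where X: "connected_allocation n X" "strongly_proportional n V w X" by blast
  then have "\<forall>i\<in>{1..n}. \<exists>a b. 0 \<le> a \<and> a \<le> b \<and> b \<le> 1 \<and> X i = {a..b}"
    by (simp add: connected_allocation_def cake_interval_def)
  then obtain a b where ab: "\<And>i. i \<in> {1..n} \<Longrightarrow> 0 \<le> a i \<and> a i \<le> b i \<and> b i \<le> 1 \<and> X i = {a i..b i}"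
    by metis
  have val: "w i < V i (X i)" if "i \<in> {1..n}" for i
    using X(2) that by (simp add: strongly_proportional_def)
  have "a i < b i" if "i \<in> {1..n}" for i
  proof -
    have "a i \<noteq> b i"
      using ab[OF that] val[OF that] w[OF that] valuation_singleton[OF V[OF that], of "a i"] by auto
    then show ?thesis using ab[OF that] by simp
  qed
  moreover have "insert 0 (\<Union>i\<in>{1..n}. X i) = {0..1}"
    using X(1) by (auto simp: connected_allocation_def allocation_def cake_def)
  ultimately show "sequential_division V w {1..n} 1"
    using X(1) ab val
    by (intro sequential_division_of_pieces[where X = X and a = a and b = b])
      (auto simp: connected_allocation_def allocation_def)
next
  assume "sequential_division V w {1..n} 1"
  then obtain X where X: "\<And>i. i \<in> {1..n} \<Longrightarrow> \<exists>a b. 0 \<le> a \<and> a < b \<and> b \<le> 1 \<and> X i = {a..b}"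
    "insert 0 (\<Union>i\<in>{1..n}. X i) = {0..1}"
    "\<forall>i\<in>{1..n}. \<forall>j\<in>{1..n}. i \<noteq> j \<longrightarrow> X i \<inter> X j \<subseteq> frontier (X i) \<inter> frontier (X j)"
    "\<forall>i\<in>{1..n}. w i < V i (X i)"
    using sequential_division_pieces[of V w "{1..n}" 1] by metis
  have int: "\<forall>i\<in>{1..n}. cake_interval (X i)"
    using X(1) unfolding cake_interval_def by (meson less_imp_le)
  let ?U = "\<Union>i\<in>{1..n}. X i"
  \<comment> \<open>The pieces are only known to cover the cake up to the inserted point 0. Being
    closed and covering \<open>{0<..1}\<close>, their union contains 0 too.\<close>
  have "closed ?U"
    using int by (intro closed_UN) (auto simp: cake_interval_def)
  moreover have "{0<..1} \<subseteq> ?U"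
  proof
    fix y :: real assume "y \<in> {0<..1}"
    then have "y \<in> insert 0 ?U" "y \<noteq> 0" unfolding X(2) by auto
    then show "y \<in> ?U" by blast
  qed
  ultimately have "closure {0<..1} \<subseteq> ?U" by (intro closure_minimal)
  then have "0 \<in> ?U" by (simp add: subset_iff)
  then have "?U = cake" using X(2) unfolding cake_def by (simp add: insert_absorb)
  moreover have "\<forall>i\<in>{1..n}. \<exists>F. finite F \<and> (\<forall>I\<in>F. cake_interval I) \<and> X i = \<Union>F"
    using int by (intro ballI exI[of _ "{X _}"]) auto
  ultimately have "connected_allocation n X"
    using X(3) int by (simp add: connected_allocation_def allocation_def)
  then show "\<exists>X. connected_allocation n X \<and> strongly_proportional n V w X"
    using X(4) by (auto simp: strongly_proportional_def)
qed

section \<open>The table\<close>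

text \<open>One step of the recursion. The infimum in \<open>ereal\<close> is infinity when all
  marks are infinite, which agrees with the initial value in the algorithm.\<close>

definition table_entry ::
    "(nat \<Rightarrow> real set \<Rightarrow> real) \<Rightarrow> (nat \<Rightarrow> real) \<Rightarrow> (nat set \<Rightarrow> ereal) \<Rightarrow> nat set \<Rightarrow> ereal" where
  "table_entry V w b N = (INF i\<in>N. answer V (Mark i (b (N - {i})) (w i)))"

text \<open>The facts on marks require a starting point in the cake; this makes every finite table
  entry such a point.\<close>

lemma table_bounds:
  assumes V: "\<And>i. i \<in> A \<Longrightarrow> valuation (V i)"
    and w: "\<And>i. i \<in> A \<Longrightarrow> 0 < w i"
    and b0: "b {} = 0"
    and b: "\<And>N. N \<subseteq> A \<Longrightarrow> N \<noteq> {} \<Longrightarrow> b N = table_entry V w b N"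
    and N: "finite N" "N \<subseteq> A"
  shows "0 \<le> b N \<and> (b N \<noteq> \<infinity> \<longrightarrow> b N \<le> 1)"
  using N
proof (induction "card N" arbitrary: N)
  case 0
  then show ?case using b0 by simp
next
  case (Suc k)
  let ?f = "\<lambda>i. answer V (Mark i (b (N - {i})) (w i))"
  have f: "0 \<le> ?f i \<and> (?f i \<noteq> \<infinity> \<longrightarrow> ?f i \<le> 1)" if i: "i \<in> N" for i
  proof (cases "b (N - {i}) = \<infinity>")
    case True
    then show ?thesis by simp
  next
    case False
    have "0 \<le> b (N - {i}) \<and> (b (N - {i}) \<noteq> \<infinity> \<longrightarrow> b (N - {i}) \<le> 1)"
      by (rule Suc.hyps(1)) (use Suc i in auto)
    then obtain x where x: "b (N - {i}) = ereal x" "0 \<le> x" "x \<le> 1"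
      using False by (cases "b (N - {i})") auto
    show ?thesis
      unfolding x(1) using answer_Mark_bounds[of V i x "w i"] V w i Suc.prems x by blast
  qed
  have "N \<noteq> {}" using Suc.hyps(2) by auto
  then have bN: "b N = (INF i\<in>N. ?f i)" using b[of N] Suc.prems by (simp add: table_entry_def)
  have "b N \<le> 1" if "b N \<noteq> \<infinity>"
  proof -
    have "(INF i\<in>N. ?f i) < \<infinity>" using that bN by (simp add: less_top)
    then obtain i where "i \<in> N" "?f i < \<infinity>" unfolding INF_less_iff by blast
    then show ?thesis
      unfolding bN using f[of i] by (intro INF_lower2[of i]) (auto)
  qed
  moreover have "0 \<le> b N" unfolding bN using f by (intro INF_greatest) blast
  ultimately show ?case by blast
qed

text \<open>From left to right, an agent whose mark lies before z is placed last, and the others are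
  divided recursively. From right to left, the last agent can start at \<open>b N\<close> instead of
  the later cut y, which only adds value.\<close>

lemma table_less_iff_sequential_division:
  assumes V: "\<And>i. i \<in> A \<Longrightarrow> valuation (V i)"
    and w: "\<And>i. i \<in> A \<Longrightarrow> 0 < w i"
    and b0: "b {} = 0"
    and b: "\<And>N. N \<subseteq> A \<Longrightarrow> N \<noteq> {} \<Longrightarrow> b N = table_entry V w b N"
    and N: "finite N" "N \<subseteq> A" "N \<noteq> {}" and z: "z \<le> 1"
  shows "b N < ereal z \<longleftrightarrow> sequential_division V w N z"
proof
  show "sequential_division V w N z" if "b N < ereal z"
    using N z that
  proof (induction "card N" arbitrary: N z)
    case 0
    then show ?case by simp
  next
    case (Suc k)
    obtain i where i: "i \<in> N" and lt: "answer V (Mark i (b (N - {i})) (w i)) < ereal z"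
      using Suc.prems b[of N] by (auto simp: table_entry_def INF_less_iff)
    let ?M = "N - {i}"
    have "b ?M \<noteq> \<infinity>" using lt by auto
    moreover have "0 \<le> b ?M \<and> (b ?M \<noteq> \<infinity> \<longrightarrow> b ?M \<le> 1)"
      by (rule table_bounds[of A V w b]) (use Suc.prems V w b0 b in auto)
    ultimately obtain x where x: "b ?M = ereal x" "0 \<le> x" "x \<le> 1"
      by (cases "b ?M") auto
    have Vi: "valuation (V i)" "0 < w i" using V w i Suc.prems by auto
    have xz: "x < z" "w i < V i {x..z}"
      using lt answer_Mark_less_iff[of V i x "w i" z] Vi x Suc.prems(4) by auto
    have "\<exists>y. sequential_division V w ?M y \<and> y < z \<and> w i < V i {y..z}"
    \<comment> \<open>For nonempty \<open>?M\<close> the recursion divides \<open>{0..y}\<close>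
      only for y strictly beyond its entry x, so the cut is moved right within the surplus of agent
      i. For empty \<open>?M\<close> the cut has to stay at 0.\<close>
    proof (cases "?M = {}")
      case True
      then have "x = 0" using x(1) b0 by (metis ereal_eq_0(2))
      then show ?thesis using True xz sequential_division.empty by metis
    next
      case False
      obtain y where y: "x < y" "y < z" "w i < V i {y..z}"
        using valuation_shrink_left[OF Vi(1) x(2) xz(1) \<open>z \<le> 1\<close> xz(2)] .
      have "sequential_division V w ?M y"
        by (rule Suc.hyps(1)) (use Suc.hyps(2) Suc.prems i y x False in auto)
      then show ?thesis using y by blast
    qed
    then obtain y where "sequential_division V w ?M y" "y < z" "w i < V i {y..z}" by blast
    then have "sequential_division V w (insert i ?M) z"
      by (intro sequential_division.insert) auto
    then show ?case using i by (simp add: insert_absorb)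
  qed
next
  assume "sequential_division V w N z"
  \<comment> \<open>The empty division ends exactly at \<open>b {} = 0\<close>, so strictness has to
    be waived there for the induction.\<close>
  then have "if N = {} then z = 0 else b N < ereal z"
    using N(2) z
  proof (induction rule: sequential_division.induct)
    case empty
    then show ?case by simp
  next
    case (insert N y i z)
    have Vi: "valuation (V i)" "0 < w i" using V w insert.prems by auto
    have y: "0 \<le> y" using insert.hyps(1) by (rule sequential_division_nonneg)
    have "b N \<le> ereal y"
      using insert b0 by (auto split: if_splits simp: zero_ereal_def)
    moreover have "0 \<le> b N"
      using table_bounds[of A V w b N] V w b0 b insert.prems sequential_division_finite[OF insert.hyps(1)]
      by auto
    ultimately obtain x where x: "b N = ereal x" "0 \<le> x" "x \<le> y"
      by (cases "b N") auto
    have "V i {y..z} \<le> V i {x..z}"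
      using valuation_mono[OF Vi(1), of x y z z] x insert by simp
    then have "answer V (Mark i (b N) (w i)) < ereal z"
      unfolding x(1) using x insert y Vi by (subst answer_Mark_less_iff) auto
    moreover have "b (insert i N) \<le> answer V (Mark i (b N) (w i))"
      using b[of "insert i N"] insert.prems insert.hyps(2)
      by (auto simp: table_entry_def intro!: INF_lower2[of i])
    ultimately show ?case by simp
  qed
  then show "b N < ereal z" using N(3) by simp
qed

section \<open>Running the algorithm\<close>

lemma result_bind_alg:
  "result V (bind_alg a f) = result V (f (result V a))"
  by (induction a) auto

lemma num_queries_bind_alg:
  "num_queries V (bind_alg a f) = num_queries V a + num_queries V (f (result V a))"
  by (induction a) auto

lemma num_queries_for_each:
  assumes "\<And>x s. x \<in> set xs \<Longrightarrow> num_queries V (f x s) = c x"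
  shows "num_queries V (for_each xs f s) = (\<Sum>x\<leftarrow>xs. c x)"
  using assms by (induction xs arbitrary: s) (auto simp: num_queries_bind_alg)

text \<open>The loop writes only entry N and reads only entries \<open>N - {i}\<close> with i in N,
  so all its marks can be computed from the initial table.\<close>

lemma result_agent_loop:
  assumes "set is \<subseteq> N"
  shows "result V (for_each is (agent_step w N) b) =
    b(N := inf (b N) (INF i\<in>set is. answer V (Mark i (b (N - {i})) (w i))))"
  using assms
proof (induction "is" arbitrary: b)
  case Nil
  then show ?case by (simp add: top_ereal_def[symmetric])
next
  case (Cons i "is")
  define b' where "b' = result V (agent_step w N i b)"
  have b': "b' = b(N := inf (b N) (answer V (Mark i (b (N - {i})) (w i))))"
    by (auto simp: b'_def agent_step_def inf_ereal_def min_def fun_eq_iff)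
  have "b' (N - {j}) = b (N - {j})" if "j \<in> set is" for j
    using that Cons.prems by (auto simp: b')
  then have "(INF j\<in>set is. answer V (Mark j (b' (N - {j})) (w j))) =
      (INF j\<in>set is. answer V (Mark j (b (N - {j})) (w j)))"
    by (intro INF_cong) (auto)
  then have "result V (for_each (i # is) (agent_step w N) b) =
      b'(N := inf (b' N) (INF j\<in>set is. answer V (Mark j (b (N - {j})) (w j))))"
    using Cons.IH[of b'] Cons.prems by (simp add: result_bind_alg b'_def fun_upd_def)
  then show ?case by (simp add: b' min.assoc)
qed

lemma result_subset_step:
  assumes "set (agents N) = N"
  shows "result V (subset_step w agents N b) = b(N := table_entry V w b N)"
proof -
  have "(INF i\<in>N. answer V (Mark i ((b(N := \<infinity>)) (N - {i})) (w i))) = table_entry V w b N"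
    unfolding table_entry_def by (intro INF_cong) auto
  then show ?thesis
    using assms by (simp add: subset_step_def result_agent_loop top_ereal_def[symmetric]
       )
qed

lemma num_queries_subset_step:
  "num_queries V (subset_step w agents N b) = length (agents N)"
  using num_queries_for_each[of "agents N" V "agent_step w N" "\<lambda>_. 1" "b(N := \<infinity>)"]
  by (simp add: subset_step_def agent_step_def sum_list_triv)

text \<open>The loop invariant, with D the sets processed so far. Both sides of the recursion refer
  to the same table, so later updates must not change an entry that D depends on.\<close>

definition filled ::
    "(nat \<Rightarrow> real set \<Rightarrow> real) \<Rightarrow> (nat \<Rightarrow> real) \<Rightarrow> nat set set \<Rightarrow> (nat set \<Rightarrow> ereal) \<Rightarrow> bool" where
  "filled V w D b \<longleftrightarrow> b {} = 0 \<and> (\<forall>N\<in>D. b N = table_entry V w b N)"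

lemma filled_update:
  assumes "filled V w D b" "N \<noteq> {}" "\<And>M i. M \<in> D \<Longrightarrow> i \<in> M \<Longrightarrow> M - {i} \<noteq> N"
  shows "filled V w (insert N D) (b(N := table_entry V w b N))"
proof -
  let ?b = "b(N := table_entry V w b N)"
  have "table_entry V w ?b M = table_entry V w b M" if "M \<in> insert N D" for M
    unfolding table_entry_def using that assms(3) by (intro INF_cong) (auto)
  then show ?thesis using assms(1,2) by (auto simp: filled_def)
qed

text \<open>Sets in D have at most k elements and read entries of smaller sets, whereas this loop
  writes entries of size k. Hence the order of the sets within one size is irrelevant.\<close>

lemma filled_subset_loop:
  assumes "filled V w D b"
    and "\<And>N. N \<in> set Ns \<Longrightarrow> set (agents N) = N \<and> card N = k \<and> N \<noteq> {}"
    and "\<And>M. M \<in> D \<Longrightarrow> finite M \<and> card M \<le> k"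
    and "0 < k"
  shows "filled V w (D \<union> set Ns) (result V (for_each Ns (subset_step w agents) b))"
  using assms(1-3)
proof (induction Ns arbitrary: b D)
  case Nil
  then show ?case by simp
next
  case (Cons N Ns)
  have "M - {i} \<noteq> N" if "M \<in> D" "i \<in> M" for M i
  proof -
    have "card (M - {i}) < card M" using Cons.prems(3) that by (intro card_Diff1_less) auto
    moreover have "card M \<le> k" "card N = k"
      using Cons.prems(2)[of N] Cons.prems(3)[of M] that by simp_all
    ultimately show ?thesis by (metis leD)
  qed
  then have "filled V w (insert N D) (b(N := table_entry V w b N))"
    using Cons.prems by (intro filled_update) auto
  then have "filled V w (insert N D \<union> set Ns)
      (result V (for_each Ns (subset_step w agents) (b(N := table_entry V w b N))))"
    by (rule Cons.IH) (use Cons.prems assms(4) in \<open>auto intro: card_ge_0_finite\<close>)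
  then show ?case
    using Cons.prems by (simp add: result_bind_alg result_subset_step)
qed

lemma result_for_each_append:
  "result V (for_each (xs @ ys) f s) = result V (for_each ys f (result V (for_each xs f s)))"
  by (induction xs arbitrary: s) (auto simp: result_bind_alg)

lemma filled_size_loop:
  assumes subs: "\<And>k. k \<in> {1..n} \<Longrightarrow> set (subs k) = {N. N \<subseteq> {1..n} \<and> card N = k}"
    and agents: "\<And>N. N \<subseteq> {1..n} \<Longrightarrow> set (agents N) = N"
    and "m \<le> n" and b: "b {} = 0"
  shows "filled V w {N. N \<subseteq> {1..n} \<and> N \<noteq> {} \<and> card N \<le> m}
    (result V (for_each [1..<Suc m] (\<lambda>k. for_each (subs k) (subset_step w agents)) b))"
  using \<open>m \<le> n\<close>
proof (induction m)
  case 0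
  have "N = {}" if "N \<subseteq> {1..n}" "card N \<le> 0" for N
    using finite_subset[OF that(1)] that(2) by simp
  then show ?case unfolding filled_def using b by simp blast
next
  case (Suc m)
  let ?D = "\<lambda>m. {N. N \<subseteq> {1..n} \<and> N \<noteq> {} \<and> card N \<le> m}"
  define b' where
    "b' = result V (for_each [1..<Suc m] (\<lambda>k. for_each (subs k) (subset_step w agents)) b)"
  have set_subs: "set (subs (Suc m)) = {N. N \<subseteq> {1..n} \<and> card N = Suc m}"
    using subs[of "Suc m"] Suc.prems by simp
  have "filled V w (?D m) b'" using Suc by (simp add: b'_def del: upt_Suc)
  then have "filled V w (?D m \<union> set (subs (Suc m)))
      (result V (for_each (subs (Suc m)) (subset_step w agents) b'))"
    by (rule filled_subset_loop[where k = "Suc m"])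
      (use agents finite_subset[of _ "{1..n}"] in \<open>auto simp: set_subs\<close>)
  moreover have "?D m \<union> set (subs (Suc m)) = ?D (Suc m)"
    unfolding set_subs by auto
  moreover have "[1..<Suc (Suc m)] = [1..<Suc m] @ [Suc m]" by simp
  ultimately show ?case
    by (simp add: result_for_each_append b'_def result_bind_alg del: upt_Suc)
qed

section \<open>The number of queries\<close>

lemma num_queries_strong_prop_algorithm:
  assumes subs: "\<And>k. k \<in> {1..n} \<Longrightarrow>
      subs k \<in> permutations_of_set {N. N \<subseteq> {1..n} \<and> card N = k}"
    and agents: "\<And>N. N \<subseteq> {1..n} \<Longrightarrow> agents N \<in> permutations_of_set N"
  shows "num_queries V (strong_prop_algorithm n w subs agents) = n * 2 ^ (n - 1)"
proof -
  \<comment> \<open>The cost does not depend on the table b: each of the \<open>n choose k\<close>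
    sets asks one query per element, whatever the answers are.\<close>
  have size: "num_queries V (for_each (subs k) (subset_step w agents) b) = k * (n choose k)"
    if k: "k \<in> {1..n}" for k b
  proof -
    have "num_queries V (subset_step w agents N b) = k" if "N \<in> set (subs k)" for N b
    proof -
      have "N \<subseteq> {1..n}" "card N = k"
        using that permutations_of_setD(1)[OF subs[OF k]] by auto
      then show ?thesis
        using agents[of N] by (simp add: num_queries_subset_step length_finite_permutations_of_set)
    qed
    then have "num_queries V (for_each (subs k) (subset_step w agents) b) = (\<Sum>N\<leftarrow>subs k. k)"
      by (rule num_queries_for_each)
    also have "\<dots> = length (subs k) * k" by (simp add: sum_list_triv)
    also have "length (subs k) = n choose k"
      using length_finite_permutations_of_set[OF subs[OF k]] n_subsets[of "{1..n}" k] by simp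
    finally show ?thesis by simp
  qed
  have "num_queries V (strong_prop_algorithm n w subs agents) = (\<Sum>k\<leftarrow>[1..<Suc n]. k * (n choose k))"
    unfolding strong_prop_algorithm_def num_queries_bind_alg
    by (subst num_queries_for_each[where c = "\<lambda>k. k * (n choose k)"]) (use size in auto)
  also have "\<dots> = (\<Sum>k\<in>{1..<Suc n}. k * (n choose k))"
    by (simp add: sum_list_distinct_conv_sum_set del: upt_Suc)
  \<comment> \<open>The added term k = 0 vanishes.\<close>
  also have "\<dots> = (\<Sum>k\<le>n. k * (n choose k))"
    by (rule sum.mono_neutral_left) auto
  also have "\<dots> = n * 2 ^ (n - 1)" by (rule choose_linear_sum)
  finally show ?thesis .
qed

theorem theorem8:
  fixes n :: nat
    and V :: "nat \<Rightarrow> real set \<Rightarrow> real"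
    and w :: "nat \<Rightarrow> real"
    and subs :: "nat \<Rightarrow> nat set list"
    and agents :: "nat set \<Rightarrow> nat list"
  assumes "\<And>i. i \<in> {1..n} \<Longrightarrow> valuation (V i)"
    and "\<And>i. i \<in> {1..n} \<Longrightarrow> w i > 0"
    and "(\<Sum>i\<in>{1..n}. w i) = 1"
    and "\<And>k. k \<in> {1..n} \<Longrightarrow>
           subs k \<in> permutations_of_set {N. N \<subseteq> {1..n} \<and> card N = k}"
    and "\<And>N. N \<subseteq> {1..n} \<Longrightarrow> agents N \<in> permutations_of_set N"
  shows "(result V (strong_prop_algorithm n w subs agents) \<longleftrightarrow>
            (\<exists>X. connected_allocation n X \<and> strongly_proportional n V w X)) \<and>
         num_queries V (strong_prop_algorithm n w subs agents) \<le> n * 2 ^ (n - 1)"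
proof
  \<comment> \<open>With no agents the entitlements would sum to 0.\<close>
  have n: "0 < n" using assms(3) by (cases n) auto
  define b where "b = result V (for_each [1..<Suc n]
    (\<lambda>k. for_each (subs k) (subset_step w agents)) ((\<lambda>_. undefined)({} := 0)))"
  have "filled V w {N. N \<subseteq> {1..n} \<and> N \<noteq> {} \<and> card N \<le> n} b"
    unfolding b_def
    by (rule filled_size_loop)
      (use permutations_of_setD(1)[OF assms(4)] permutations_of_setD(1)[OF assms(5)] in simp_all)
  \<comment> \<open>After the last round the size bound in the invariant holds for every set of
    agents, so the recursion is valid throughout the table.\<close>
  moreover have "card N \<le> n" if "N \<subseteq> {1..n}" for N
    using card_mono[OF _ that] by simp
  ultimately have b: "b {} = 0" "\<And>N. N \<subseteq> {1..n} \<Longrightarrow> N \<noteq> {} \<Longrightarrow> b N = table_entry V w b N"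
    by (auto simp: filled_def)
  have "result V (strong_prop_algorithm n w subs agents) \<longleftrightarrow> b {1..n} < ereal 1"
    by (simp add: strong_prop_algorithm_def result_bind_alg b_def one_ereal_def del: upt_Suc)
  also have "\<dots> \<longleftrightarrow> sequential_division V w {1..n} 1"
    by (rule table_less_iff_sequential_division[where A = "{1..n}"]) (use assms(1,2) b n in auto)
  also have "\<dots> \<longleftrightarrow> (\<exists>X. connected_allocation n X \<and> strongly_proportional n V w X)"
    using allocation_iff_sequential_division[of n V w] assms(1,2) n by blast
  finally show "result V (strong_prop_algorithm n w subs agents) \<longleftrightarrow>
      (\<exists>X. connected_allocation n X \<and> strongly_proportional n V w X)" .
  show "num_queries V (strong_prop_algorithm n w subs agents) \<le> n * 2 ^ (n - 1)"
    using num_queries_strong_prop_algorithm[OF assms(4,5)] by simp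
qed

end
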